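(* There exist computably enumerable sets $A, B \subseteq \omega$ such that $B \le_{wtt} A$, $A \cap B = \emptyset$, $\omega \setminus (A \cup B)$ is infinite, and no separator $Z$ of $A$ and $B$ satisfies $Z \ge_T \emptyset'$.
   Context: A separator of disjoint sets $A, B \subseteq \omega$ is a set $Z \subseteq \omega$ (not necessarily computably enumerable) with $A \subseteq Z$ and $Z \cap B = \emptyset$. Here $\le_T$ is Turing reducibility, $\emptyset'$ is the halting set, and $\le_{wtt}$ is weak truth table reducibility: $X \le_{wtt} Y$ if $X$ is computed from oracle $Y$ by a Turing functional whose use on that computation is bounded by a computable function of the input. *)

theory Defs
  imports Main "HOL-Library.Nat_Bijection"
begin

text \<open>
  Turing functionals are given by programs for unary partial functions on the natural numbers,
  recursive in a set used as an oracle.  Tuples are passed through the Cantor pairing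
  \<^const>\<open>prod_encode\<close>.
\<close>

datatype prog =
    Zero
  | Succ
  | First
  | Second
  | Query
  | Pairing prog prog
  | Comp prog prog
  | Rec prog prog
  | Mu prog

text \<open>
  \<open>run Y p x v Q\<close>: program \<open>p\<close> with oracle \<open>Y\<close> halts on input \<open>x\<close> with output \<open>v\<close>, and \<open>Q\<close> is
  the set of all numbers about which the oracle is queried during this computation.
  On input \<open>(a, m)\<close>, \<open>Mu p\<close> tests \<open>p (a, m)\<close>, \<open>p (a, m + 1)\<close> and so on and returns the first
  \<open>n\<close> with \<open>p (a, n) = 0\<close>; it diverges if some earlier test does.  Ordinary minimisation is
  \<open>m = 0\<close>.
\<close>

inductive run :: "nat set \<Rightarrow> prog \<Rightarrow> nat \<Rightarrow> nat \<Rightarrow> nat set \<Rightarrow> bool" for Y :: "nat set" where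
  Zero: "run Y Zero x 0 {}"
| Succ: "run Y Succ x (Suc x) {}"
| First: "run Y First x (fst (prod_decode x)) {}"
| Second: "run Y Second x (snd (prod_decode x)) {}"
| Query: "run Y Query x (of_bool (x \<in> Y)) {x}"
| Pairing: "run Y p x u Q \<Longrightarrow> run Y q x v R \<Longrightarrow>
    run Y (Pairing p q) x (prod_encode (u, v)) (Q \<union> R)"
| Comp: "run Y q x u Q \<Longrightarrow> run Y p u v R \<Longrightarrow> run Y (Comp p q) x v (Q \<union> R)"
| Rec_0: "run Y p a v Q \<Longrightarrow> run Y (Rec p q) (prod_encode (a, 0)) v Q"
| Rec_Suc: "run Y (Rec p q) (prod_encode (a, n)) u Q \<Longrightarrow>
    run Y q (prod_encode (a, prod_encode (n, u))) v R \<Longrightarrow>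
    run Y (Rec p q) (prod_encode (a, Suc n)) v (Q \<union> R)"
| Mu_stop: "run Y p (prod_encode (a, m)) 0 Q \<Longrightarrow> run Y (Mu p) (prod_encode (a, m)) m Q"
| Mu_next: "run Y p (prod_encode (a, m)) (Suc w) Q \<Longrightarrow>
    run Y (Mu p) (prod_encode (a, Suc m)) n R \<Longrightarrow>
    run Y (Mu p) (prod_encode (a, m)) n (Q \<union> R)"

inductive_cases run_cases:
  "run Y Zero x v Q" "run Y Succ x v Q" "run Y First x v Q" "run Y Second x v Q"
  "run Y Query x v Q" "run Y (Pairing p q) x v Q" "run Y (Comp p q) x v Q"
  "run Y (Rec p q) x v Q" "run Y (Mu p) x v Q"

lemma run_deterministic:
  assumes "run Y p x v Q" and "run Y p x v' Q'"
  shows "v = v' \<and> Q = Q'"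
  using assms
proof (induction arbitrary: v' Q' rule: run.induct)
  case (Pairing p x u Q q v R)
  from Pairing.prems show ?case by (rule run_cases) (metis Pairing.IH)
next
  case (Comp q x u Q p v R)
  from Comp.prems show ?case by (rule run_cases) (metis Comp.IH)
next
  case (Rec_0 p a v Q q)
  from Rec_0.prems show ?case by (rule run_cases) (use Rec_0.IH in auto)
next
  case (Rec_Suc p q a n u Q v R)
  from Rec_Suc.prems show ?case
    by (rule run_cases) (simp_all, metis Rec_Suc.IH)
next
  case (Mu_stop p a m Q)
  from Mu_stop.prems show ?case
    by (rule run_cases) (simp_all, metis Mu_stop.IH, metis Mu_stop.IH nat.distinct(1))
next
  case (Mu_next p a m w Q n R)
  from Mu_next.prems show ?case
    by (rule run_cases) (simp_all, metis Mu_next.IH(1) nat.distinct(1), metis Mu_next.IH)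
qed (auto elim: run_cases)

definition halts :: "nat set \<Rightarrow> prog \<Rightarrow> nat \<Rightarrow> bool" where
  "halts Y p x \<longleftrightarrow> (\<exists>v Q. run Y p x v Q)"

text \<open>
  Goedel numbering of the programs: an explicit, effective bijection onto the natural numbers.
\<close>

primrec index :: "prog \<Rightarrow> nat" where
  "index Zero = 0"
| "index Succ = 1"
| "index First = 2"
| "index Second = 3"
| "index Query = 4"
| "index (Pairing p q) = 5 + 4 * prod_encode (index p, index q)"
| "index (Comp p q) = 6 + 4 * prod_encode (index p, index q)"
| "index (Rec p q) = 7 + 4 * prod_encode (index p, index q)"
| "index (Mu p) = 8 + 4 * index p"

lemma bij_index: "bij index"
proof (rule bijI)
  have "index p = index q \<Longrightarrow> p = q" for p q
  proof (induction p arbitrary: q)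
    case Zero then show ?case by (cases q) auto
  next
    case Succ then show ?case by (cases q) auto
  next
    case First then show ?case by (cases q) auto
  next
    case Second then show ?case by (cases q) auto
  next
    case Query then show ?case by (cases q) auto
  next
    case (Pairing p1 p2) then show ?case by (cases q) (auto, presburger+)
  next
    case (Comp p1 p2) then show ?case by (cases q) (auto, presburger+)
  next
    case (Rec p1 p2) then show ?case by (cases q) (auto, presburger+)
  next
    case (Mu p) then show ?case by (cases q) (auto, presburger+)
  qed
  then show "inj index" by (rule injI)
  have "\<exists>p. index p = n" for n
  proof (induction n rule: less_induct)
    case (less n)
    show ?case
    proof (cases "n < 5")
      case True
      then have "n = 0 \<or> n = 1 \<or> n = 2 \<or> n = 3 \<or> n = 4" by presburger
      then show ?thesis by (metis index.simps(1-5))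
    next
      case False
      define k where "k = (n - 5) div 4"
      obtain a b where k: "k = prod_encode (a, b)"
        by (metis prod_decode_inverse surj_pair)
      have "k < n" using False by (simp add: k_def)
      moreover have "a \<le> k" "b \<le> k"
        by (simp_all add: k le_prod_encode_1 le_prod_encode_2)
      ultimately obtain p q r where "index p = a" "index q = b" "index r = k"
        by (meson less.IH le_less_trans)
      moreover have "n = 5 + 4 * k \<or> n = 6 + 4 * k \<or> n = 7 + 4 * k \<or> n = 8 + 4 * k"
        using False unfolding k_def by presburger
      ultimately show ?thesis using k by (metis index.simps(6-9))
    qed
  qed
  then show "surj index" by (metis surjI)
qed

text \<open>
  Oracle-free computability is computability with the empty oracle, whose answers are constantly
  \<open>0\<close>.
\<close>

definition computable :: "(nat \<Rightarrow> nat) \<Rightarrow> bool" where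
  "computable f \<longleftrightarrow> (\<exists>p. \<forall>x. \<exists>Q. run {} p x (f x) Q)"

definition ce :: "nat set \<Rightarrow> bool" where
  "ce A \<longleftrightarrow> (\<exists>p. A = {x. halts {} p x})"

definition turing_le :: "nat set \<Rightarrow> nat set \<Rightarrow> bool"  (infix "\<le>\<^sub>T" 50) where
  "X \<le>\<^sub>T Y \<longleftrightarrow> (\<exists>p. \<forall>x. \<exists>Q. run Y p x (of_bool (x \<in> X)) Q)"

definition wtt_le :: "nat set \<Rightarrow> nat set \<Rightarrow> bool"  (infix "\<le>\<^sub>w\<^sub>t\<^sub>t" 50) where
  "X \<le>\<^sub>w\<^sub>t\<^sub>t Y \<longleftrightarrow> (\<exists>p g. computable g \<and>
     (\<forall>x. \<exists>Q. run Y p x (of_bool (x \<in> X)) Q \<and> Q \<subseteq> {..<g x}))"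

definition jump :: "nat set \<Rightarrow> nat set" where
  "jump Y = {e. \<exists>p. index p = e \<and> halts Y p e}"

abbreviation halting_set :: "nat set" where
  "halting_set \<equiv> jump {}"

definition separator :: "nat set \<Rightarrow> nat set \<Rightarrow> nat set \<Rightarrow> bool" where
  "separator A B Z \<longleftrightarrow> A \<subseteq> Z \<and> Z \<inter> B = {}"

end

theory Submission
  imports Defs "HOL-Library.Infinite_Set"
begin

text \<open>
  A finite injury construction.  Besides \<open>A\<close> and \<open>B\<close> enumerate a set \<open>diag\<close> such that no separator
  computes \<open>diag\<close>; as \<open>diag\<close> is computably enumerable, no separator computes the halting set.
  Requirement \<open>k\<close> looks for a finite oracle \<open>T\<close>, compatible with the present \<open>A\<close> and \<open>B\<close>, which makes
  functional \<open>k\<close> agree with the witnesses \<open>k\<close> has already put into \<open>diag\<close> and yield \<open>0\<close> at a new one.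
  It then puts the new witness into \<open>diag\<close>.  Let \<open>d\<close> be the least undecided element of \<open>T\<close> that the
  restraints allow requirement \<open>k\<close> to use: it decides all numbers from \<open>d\<close> up to the current stage as \<open>T\<close>
  prescribes, and restrains lower priorities from deciding numbers below that stage.  (If there is no such
  \<open>d\<close>, it only imposes the restraint.)

  The number \<open>d\<close> enters \<open>A\<close>, and all numbers entering \<open>B\<close> at that stage are larger; this gives
  \<open>B \<le>\<^sub>w\<^sub>t\<^sub>t A\<close>.  The undecided allowed numbers below \<open>d\<close> are outside \<open>T\<close>.  If requirement \<open>k\<close> acted
  infinitely often, then infinitely many of its acts would be true, i.e. have a \<open>d\<close> not undercut by
  any later one.  Two true acts whose oracles agree on the finitely many restrained numbers have
  oracles that agree as far as both are defined, contradicting the use of the first witness.  So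
  each requirement acts finitely often, and a separator computing \<open>diag\<close> through functional \<open>k\<close> would
  provide a further candidate on which \<open>k\<close> acts, with a witness outside \<open>diag\<close>.
\<close>

section \<open>Recursive functions\<close>

text \<open>
  The programs witnessing \<open>recursive\<close> make no query at all, so they can be used under any oracle.
\<close>
definition recursive :: "(nat \<Rightarrow> nat) \<Rightarrow> bool" where
  "recursive f \<longleftrightarrow> (\<exists>p. \<forall>Y x. run Y p x (f x) {})"

definition decidable :: "(nat \<Rightarrow> bool) \<Rightarrow> bool" where
  "decidable P \<longleftrightarrow> recursive (\<lambda>x. of_bool (P x))"

definition pi1 :: "nat \<Rightarrow> nat" where "pi1 x = fst (prod_decode x)"
definition pi2 :: "nat \<Rightarrow> nat" where "pi2 x = snd (prod_decode x)"
definition pr :: "nat \<Rightarrow> nat \<Rightarrow> nat" where "pr a b = prod_encode (a, b)"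

lemma pi_pr [simp]: "pi1 (pr a b) = a" "pi2 (pr a b) = b" "pr (pi1 x) (pi2 x) = x"
  by (simp_all add: pi1_def pi2_def pr_def)

lemma pr_inject [simp]: "pr a b = pr c d \<longleftrightarrow> a = c \<and> b = d"
  by (simp add: pr_def)

lemma pi_le: "pi1 x \<le> x" "pi2 x \<le> x"
  by (metis pi_pr(3) pr_def le_prod_encode_1, metis pi_pr(3) pr_def le_prod_encode_2)

lemma run_Pairing0: "run Y p x u {} \<Longrightarrow> run Y q x v {} \<Longrightarrow> run Y (Pairing p q) x (pr u v) {}"
  using run.Pairing[of Y p x u "{}" q v "{}"] by (simp add: pr_def)

lemma run_Comp0: "run Y q x u {} \<Longrightarrow> run Y p u v {} \<Longrightarrow> run Y (Comp p q) x v {}"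
  using run.Comp[of Y q x u "{}" p v "{}"] by simp

lemma run_id: "run Y (Pairing First Second) x x {}"
  using run_Pairing0[OF run.First run.Second, of Y x] by (simp add: pr_def)

lemma recursive_id: "recursive (\<lambda>x. x)"
  unfolding recursive_def using run_id by blast

lemma recursive_comp: "recursive f \<Longrightarrow> recursive g \<Longrightarrow> recursive (\<lambda>x. f (g x))"
  unfolding recursive_def by (meson run_Comp0)

lemma recursive_pr: "recursive f \<Longrightarrow> recursive g \<Longrightarrow> recursive (\<lambda>x. pr (f x) (g x))"
  unfolding recursive_def by (meson run_Pairing0)

lemma recursive_pi1: "recursive f \<Longrightarrow> recursive (\<lambda>x. pi1 (f x))"
  by (rule recursive_comp[of pi1]) (auto simp: recursive_def pi1_def intro: run.First)

lemma recursive_pi2: "recursive f \<Longrightarrow> recursive (\<lambda>x. pi2 (f x))"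
  by (rule recursive_comp[of pi2]) (auto simp: recursive_def pi2_def intro: run.Second)

lemma recursive_Suc: "recursive f \<Longrightarrow> recursive (\<lambda>x. Suc (f x))"
  by (rule recursive_comp[of Suc]) (auto simp: recursive_def intro: run.Succ)

lemma recursive_zero: "recursive (\<lambda>x. 0)"
  unfolding recursive_def using run.Zero by blast

lemma recursive_const: "recursive (\<lambda>x. c)"
  by (induction c) (auto intro: recursive_zero recursive_Suc)

text \<open>The whole input serves as parameter of the recursion, so base, step and length may all
  depend on it.\<close>

lemma recursive_rec_nat:
  assumes "recursive a" "recursive (\<lambda>z. h (pi1 z) (pi1 (pi2 z)) (pi2 (pi2 z)))" "recursive n"
  shows "recursive (\<lambda>x. rec_nat (a x) (h x) (n x))"
proof -
  obtain p q r where p: "\<And>Y x. run Y p x (a x) {}"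
    and q: "\<And>Y z. run Y q z (h (pi1 z) (pi1 (pi2 z)) (pi2 (pi2 z))) {}"
    and r: "\<And>Y x. run Y r x (n x) {}"
    using assms unfolding recursive_def by metis
  have "run Y (Rec p q) (pr x m) (rec_nat (a x) (h x) m) {}" for Y x m
  proof (induction m)
    case 0
    show ?case using run.Rec_0[OF p] by (simp add: pr_def)
  next
    case (Suc m)
    have "run Y q (pr x (pr m (rec_nat (a x) (h x) m))) (h x m (rec_nat (a x) (h x) m)) {}"
      using q[of Y "pr x (pr m (rec_nat (a x) (h x) m))"] by simp
    with run.Rec_Suc[of Y p q x m "rec_nat (a x) (h x) m" "{}"] Suc
    show ?case by (force simp: pr_def)
  qed
  with run_Comp0[OF run_Pairing0[OF run_id r]] show ?thesis
    unfolding recursive_def by blast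
qed

lemma recursive_add:
  assumes "recursive f" "recursive g" shows "recursive (\<lambda>x. f x + g x)"
proof -
  have "rec_nat a (\<lambda>i u. Suc u) n = a + n" for a n by (induction n) auto
  moreover have "recursive (\<lambda>z. Suc (pi2 (pi2 z)))"
    by (intro recursive_Suc recursive_pi2 recursive_id)
  ultimately show ?thesis
    using recursive_rec_nat[of f "\<lambda>x i u. Suc u", OF assms(1) _ assms(2)] by simp
qed

lemma recursive_diff:
  assumes "recursive f" "recursive g" shows "recursive (\<lambda>x. f x - g x)"
proof -
  \<comment> \<open>Returning the counter instead of the accumulated value gives the
    predecessor.\<close>
  have "rec_nat 0 (\<lambda>i u. i) n = n - 1" for n :: nat by (induction n) auto
  moreover have "recursive (\<lambda>z. pi1 (pi2 z))"
    by (intro recursive_pi1 recursive_pi2 recursive_id)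
  ultimately have pred: "recursive (\<lambda>x. x - 1)"
    using recursive_rec_nat[of "\<lambda>x. 0" "\<lambda>x i u. i", OF recursive_zero _ recursive_id] by simp
  have "rec_nat a (\<lambda>i u. u - 1) n = a - n" for a n :: nat by (induction n) auto
  moreover have "recursive (\<lambda>z. pi2 (pi2 z) - 1)"
    by (intro recursive_comp[OF pred] recursive_pi2 recursive_id)
  ultimately show ?thesis
    using recursive_rec_nat[of f "\<lambda>x i u. u - 1", OF assms(1) _ assms(2)] by simp
qed

text \<open>Products, quotients, bounded quantifiers and codes of finite sets all reduce to bounded
  sums.\<close>

lemma recursive_sum:
  assumes "recursive n" "recursive (\<lambda>z. f (pi1 z) (pi2 z))"
  shows "recursive (\<lambda>x. \<Sum>i<n x. f x i)"
proof -
  have "rec_nat 0 (\<lambda>i u. u + f x i) m = (\<Sum>i<m. f x i)" for x m by (induction m) auto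
  moreover have "recursive (\<lambda>z. pi2 (pi2 z) + f (pi1 z) (pi1 (pi2 z)))"
    using recursive_comp[OF assms(2), of "\<lambda>z. pr (pi1 z) (pi1 (pi2 z))"]
    by (simp add: recursive_add recursive_pr recursive_pi1 recursive_pi2 recursive_id)
  ultimately show ?thesis
    using recursive_rec_nat[of "\<lambda>x. 0" "\<lambda>x i u. u + f x i", OF recursive_zero _ assms(1)] by simp
qed

lemma recursive_mult:
  assumes "recursive f" "recursive g" shows "recursive (\<lambda>x. f x * g x)"
  using recursive_sum[of f "\<lambda>x i. g x"] assms recursive_comp[OF assms(2), of pi1]
    recursive_pi1[OF recursive_id] by simp

lemma recursive_power:
  assumes "recursive f" "recursive g" shows "recursive (\<lambda>x. f x ^ g x)"
proof -
  have "rec_nat 1 (\<lambda>i u. f x * u) m = f x ^ m" for x m by (induction m) auto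
  moreover have "recursive (\<lambda>z. f (pi1 z) * pi2 (pi2 z))"
    by (intro recursive_mult recursive_comp[OF assms(1)] recursive_pi1 recursive_pi2 recursive_id)
  ultimately show ?thesis
    using recursive_rec_nat[of "\<lambda>x. 1" "\<lambda>x i u. f x * u", OF recursive_const _ assms(2)] by simp
qed

section \<open>Decidable predicates\<close>

lemma recursive_of_bool: "decidable P \<Longrightarrow> recursive (\<lambda>x. of_bool (P x))"
  by (simp add: decidable_def)

lemma decidable_const: "decidable (\<lambda>x. c)"
  unfolding decidable_def by (rule recursive_const)

lemma decidable_le:
  assumes "recursive f" "recursive g" shows "decidable (\<lambda>x. f x \<le> g x)"
proof -
  have "of_bool (f x \<le> g x) = 1 - (f x - g x)" for x by auto
  then show ?thesis unfolding decidable_def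
    by (auto intro!: recursive_diff recursive_const assms)
qed

lemma decidable_not:
  assumes "decidable P" shows "decidable (\<lambda>x. \<not> P x)"
proof -
  have "of_bool (\<not> P x) = 1 - (of_bool (P x) :: nat)" for x by auto
  then show ?thesis
    using assms unfolding decidable_def by (auto intro!: recursive_diff recursive_const)
qed

lemma decidable_conj:
  assumes "decidable P" "decidable Q" shows "decidable (\<lambda>x. P x \<and> Q x)"
proof -
  have "of_bool (P x \<and> Q x) = of_bool (P x) * (of_bool (Q x) :: nat)" for x by auto
  then show ?thesis
    using assms unfolding decidable_def by (auto intro!: recursive_mult)
qed

lemma decidable_disj:
  assumes "decidable P" "decidable Q" shows "decidable (\<lambda>x. P x \<or> Q x)"
  using decidable_not[OF decidable_conj[OF decidable_not decidable_not]] assms by simp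

lemma decidable_imp:
  assumes "decidable P" "decidable Q" shows "decidable (\<lambda>x. P x \<longrightarrow> Q x)"
  using decidable_disj[OF decidable_not[OF assms(1)] assms(2)]
  by (rule back_subst[of decidable]) auto

lemma decidable_less:
  assumes "recursive f" "recursive g" shows "decidable (\<lambda>x. f x < g x)"
  using decidable_le[OF recursive_Suc] assms by (simp add: Suc_le_eq)

lemma decidable_eq:
  assumes "recursive f" "recursive g" shows "decidable (\<lambda>x. f x = g x)"
  unfolding order.eq_iff[where 'a = nat] by (intro decidable_conj decidable_le assms)

lemma decidable_iff:
  assumes "decidable P" "decidable Q" shows "decidable (\<lambda>x. P x \<longleftrightarrow> Q x)"
  using decidable_conj[OF decidable_imp[OF assms] decidable_imp[OF assms(2,1)]]
  by (rule back_subst[of decidable]) auto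

lemma decidable_bex:
  assumes "recursive n" "decidable (\<lambda>z. P (pi1 z) (pi2 z))"
  shows "decidable (\<lambda>x. \<exists>i<n x. P x i)"
proof -
  have "(\<exists>i<n x. P x i) \<longleftrightarrow> 0 < (\<Sum>i<n x. of_bool (P x i) :: nat)" for x
    by (auto simp: zero_less_iff_neq_zero simp del: sum_of_bool_eq)
  moreover have "decidable (\<lambda>x. 0 < (\<Sum>i<n x. of_bool (P x i) :: nat))"
    by (intro decidable_less recursive_sum recursive_of_bool recursive_const assms)
  ultimately show ?thesis by simp
qed

lemma decidable_ball:
  assumes "recursive n" "decidable (\<lambda>z. P (pi1 z) (pi2 z))"
  shows "decidable (\<lambda>x. \<forall>i<n x. P x i)"
  using decidable_not[OF decidable_bex[of n "\<lambda>x i. \<not> P x i"]] assms decidable_not by simp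

lemma recursive_if:
  assumes "decidable P" "recursive f" "recursive g"
  shows "recursive (\<lambda>x. if P x then f x else g x)"
proof -
  have "(if P x then f x else g x) = of_bool (P x) * f x + of_bool (\<not> P x) * g x" for x by auto
  then show ?thesis
    by (auto intro!: recursive_add recursive_mult recursive_of_bool decidable_not assms)
qed

lemma recursive_div:
  assumes "recursive f" "recursive g" shows "recursive (\<lambda>x. f x div g x)"
proof -
  \<comment> \<open>For \<open>k > 0\<close> the quotient counts the positive multiples of
    \<open>k\<close> up to \<open>m\<close>.\<close>
  have "m div k = (if k = 0 then 0 else \<Sum>i<m. of_bool (Suc i * k \<le> m))" for m k :: nat
  proof (cases "k = 0")
    case False
    have "{i. i < m \<and> Suc i * k \<le> m} = {..<m div k}"
      using False by (auto simp: less_eq_div_iff_mult_less_eq Suc_le_eq[symmetric] simp del: mult_Suc)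
        (metis False Suc_le_eq div_le_dividend le_trans less_eq_div_iff_mult_less_eq neq0_conv)
    then show ?thesis using False
      by (simp add: of_bool_def sum.If_cases Int_def del: mult_Suc)
  qed auto
  then have "(\<lambda>x. f x div g x)
      = (\<lambda>x. if g x = 0 then 0 else \<Sum>i<f x. of_bool (Suc i * g x \<le> f x))"
    by (rule ext)
  then show ?thesis
    by (simp only:) (intro recursive_if recursive_sum recursive_of_bool decidable_eq decidable_le
      recursive_mult recursive_Suc recursive_const recursive_pi1 recursive_pi2 recursive_id
      recursive_comp[OF assms(1)] recursive_comp[OF assms(2)] assms)
qed

lemma recursive_mod:
  assumes "recursive f" "recursive g" shows "recursive (\<lambda>x. f x mod g x)"
  using recursive_diff[OF assms(1) recursive_mult[OF assms(2) recursive_div[OF assms]]]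
  by (simp add: minus_mult_div_eq_mod)

lemma decidable_mem_decode:
  assumes "recursive f" "recursive g" shows "decidable (\<lambda>x. f x \<in> set_decode (g x))"
proof -
  have "f x \<in> set_decode (g x) \<longleftrightarrow> g x div 2 ^ f x mod 2 = 1" for x
    by (simp add: set_decode_def odd_iff_mod_2_eq_one)
  then show ?thesis
    by (auto intro!: decidable_eq recursive_mod recursive_div recursive_power recursive_const assms)
qed

lemma recursive_encode:
  assumes "recursive n" "decidable (\<lambda>z. P (pi1 z) (pi2 z))"
  shows "recursive (\<lambda>x. set_encode {i. i < n x \<and> P x i})"
proof -
  have "set_encode {i. i < m \<and> Q i} = (\<Sum>i<m. of_bool (Q i) * 2 ^ i)" for m Q
    unfolding set_encode_def
    by (rule sum.mono_neutral_cong_left) auto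
  then have "(\<lambda>x. set_encode {i. i < n x \<and> P x i})
      = (\<lambda>x. \<Sum>i<n x. of_bool (P x i) * 2 ^ i)"
    by (rule ext)
  then show ?thesis
    by (simp only:) (intro recursive_sum recursive_mult recursive_power recursive_of_bool
      recursive_const recursive_pi2 recursive_id assms)
qed

lemmas recursive_intros = recursive_id recursive_const recursive_pr recursive_pi1 recursive_pi2
  recursive_Suc recursive_add recursive_diff recursive_mult recursive_div recursive_mod
  recursive_power recursive_of_bool recursive_if recursive_sum recursive_encode
  decidable_const decidable_le decidable_less decidable_eq decidable_not decidable_conj
  decidable_disj decidable_imp decidable_iff decidable_bex decidable_ball decidable_mem_decode

section \<open>Bounded simulation of oracle programs\<close>

text \<open>
  A stack machine on codes.  A configuration \<open>pr a K\<close> is a current value \<open>a\<close> with a stack \<open>K\<close> of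
  tasks.  Tag 0 applies the program with index \<open>d\<close> to the value, tag 1 pairs \<open>d\<close> with the value,
  tag 2 saves the first component of a pairing before the second is computed, and tag 3 inspects
  the outcome of a test made by \<open>Mu\<close>.  A query at or above the bound \<open>u\<close> makes the machine loop, so
  a computation that reaches the empty stack depends on the oracle below \<open>u\<close> only.
\<close>
definition push :: "nat \<Rightarrow> nat \<Rightarrow> nat \<Rightarrow> nat" where
  "push tag d K = Suc (pr (pr tag d) K)"

text \<open>Here \<open>j\<close> selects pairing, composition, recursion or minimisation, and
  \<open>q\<close> codes the subprograms, inverting \<open>index\<close>. After a recursive call
  with value \<open>u\<close>, the two tag 1 tasks rebuild the argument \<open>(a, (n, u))\<close>
  of the step program.\<close>

definition exec_compound :: "nat \<Rightarrow> nat \<Rightarrow> nat \<Rightarrow> nat \<Rightarrow> nat \<Rightarrow> nat" where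
  "exec_compound e j q a K =
    (if j = 0 then pr a (push 0 (pi1 q) (push 2 (pr a (pi2 q)) K))
     else if j = 1 then pr a (push 0 (pi2 q) (push 0 (pi1 q) K))
     else if j = 2 then
       (if pi2 a = 0 then pr (pi1 a) (push 0 (pi1 q) K)
        else pr (pr (pi1 a) (pi2 a - 1))
          (push 0 e (push 1 (pi2 a - 1) (push 1 (pi1 a) (push 0 (pi2 q) K)))))
     else pr a (push 0 q (push 3 (pr a q) K)))"

definition exec :: "nat set \<Rightarrow> nat \<Rightarrow> nat \<Rightarrow> nat \<Rightarrow> nat \<Rightarrow> nat" where
  "exec T u e a K =
    (if e = 0 then pr 0 K
     else if e = 1 then pr (Suc a) K
     else if e = 2 then pr (pi1 a) K
     else if e = 3 then pr (pi2 a) K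
     else if e = 4 then (if a < u then pr (of_bool (a \<in> T)) K else pr a (push 0 4 K))
     else exec_compound e ((e - 5) mod 4) ((e - 5) div 4) a K)"

text \<open>\<open>8 + 4 * pi2 d\<close> is the index of the minimisation with body
  \<open>pi2 d\<close>, restarted at the next argument after a nonzero test.\<close>

definition step_task :: "nat set \<Rightarrow> nat \<Rightarrow> nat \<Rightarrow> nat \<Rightarrow> nat \<Rightarrow> nat \<Rightarrow> nat" where
  "step_task T u tag d a K =
    (if tag = 0 then exec T u d a K
     else if tag = 1 then pr (pr d a) K
     else if tag = 2 then pr (pi1 d) (push 0 (pi2 d) (push 1 a K))
     else if a = 0 then pr (pi2 (pi1 d)) K
     else pr (pr (pi1 (pi1 d)) (Suc (pi2 (pi1 d)))) (push 0 (8 + 4 * pi2 d) K))"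

definition step :: "nat set \<Rightarrow> nat \<Rightarrow> nat \<Rightarrow> nat" where
  "step T u c =
    (if pi2 c = 0 then c
     else step_task T u (pi1 (pi1 (pi2 c - 1))) (pi2 (pi1 (pi2 c - 1))) (pi1 c) (pi2 (pi2 c - 1)))"

text \<open>One number bounds both steps and queries, so a stage has to code only one bound. The
  result \<open>pr v 0\<close> means halting with output \<open>v\<close>.\<close>

definition config :: "nat set \<Rightarrow> nat \<Rightarrow> nat \<Rightarrow> nat \<Rightarrow> nat" where
  "config T u e x = (step T u ^^ u) (pr x (push 0 e 0))"

lemma step_push [simp]: "step T u (pr a (push tag d K)) = step_task T u tag d a K"
  by (simp add: step_def push_def)

lemma step_halted: "(step T u ^^ n) (pr v 0) = pr v 0"
  by (induction n) (simp_all add: step_def)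

lemma run_finite_use: "run Y p x v Q \<Longrightarrow> finite Q"
  by (induction rule: run.induct) auto

lemma funpow_step: "f a = b \<Longrightarrow> (f ^^ n) b = c \<Longrightarrow> (f ^^ Suc n) a = c"
  by (simp add: funpow_swap1)

lemma funpow_chain: "(f ^^ m) a = b \<Longrightarrow> (f ^^ n) b = c \<Longrightarrow> (f ^^ (n + m)) a = c"
  by (simp add: funpow_add)

text \<open>The number of steps is uniform in stack and bound, because subcomputations run on top of
  pending tasks and the bound is fixed only later.\<close>

lemma run_imp_steps:
  assumes "run Y p x v Q"
  shows "\<exists>n. \<forall>K u. Q \<subseteq> {..<u} \<longrightarrow> (step Y u ^^ n) (pr x (push 0 (index p) K)) = pr v K"
  using assms
proof (induction rule: run.induct)
  case (Zero x)
  show ?case by (rule exI[of _ 1]) (simp add: step_task_def exec_def)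
next
  case (Succ x)
  show ?case by (rule exI[of _ 1]) (simp add: step_task_def exec_def)
next
  case (First x)
  show ?case by (rule exI[of _ 1]) (simp add: step_task_def exec_def pi1_def)
next
  case (Second x)
  show ?case by (rule exI[of _ 1]) (simp add: step_task_def exec_def pi2_def)
next
  case (Query x)
  show ?case by (rule exI[of _ 1]) (simp add: step_task_def exec_def)
next
  case (Pairing p x v1 Q q v2 R)
  obtain n m where
    n: "\<And>K u. Q \<subseteq> {..<u} \<Longrightarrow> (step Y u ^^ n) (pr x (push 0 (index p) K)) = pr v1 K" and
    m: "\<And>K u. R \<subseteq> {..<u} \<Longrightarrow> (step Y u ^^ m) (pr x (push 0 (index q) K)) = pr v2 K"
    using Pairing.IH by blast
  \<comment> \<open>One step unfolds the pairing, \<open>n\<close> compute the first component, one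
    stores it, \<open>m\<close> compute the second and one forms the pair.\<close>
  have "(step Y u ^^ Suc (Suc (1 + m) + n)) (pr x (push 0 (index (Pairing p q)) K))
      = pr (prod_encode (v1, v2)) K" if "Q \<union> R \<subseteq> {..<u}" for K u
  proof (intro funpow_step funpow_chain)
    show "step Y u (pr x (push 0 (index (Pairing p q)) K))
      = pr x (push 0 (index p) (push 2 (pr x (index q)) K))"
      by (simp add: step_task_def exec_def exec_compound_def flip: pr_def)
    show "(step Y u ^^ n) (pr x (push 0 (index p) (push 2 (pr x (index q)) K)))
      = pr v1 (push 2 (pr x (index q)) K)" using n that by simp
    show "step Y u (pr v1 (push 2 (pr x (index q)) K)) = pr x (push 0 (index q) (push 1 v1 K))"
      by (simp add: step_task_def)
    show "(step Y u ^^ m) (pr x (push 0 (index q) (push 1 v1 K))) = pr v2 (push 1 v1 K)"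
      using m that by simp
    show "(step Y u ^^ 1) (pr v2 (push 1 v1 K)) = pr (prod_encode (v1, v2)) K"
      by (simp add: step_task_def flip: pr_def)
  qed
  then show ?case by blast
next
  case (Comp q x w Q p v R)
  obtain n m where
    n: "\<And>K u. Q \<subseteq> {..<u} \<Longrightarrow> (step Y u ^^ n) (pr x (push 0 (index q) K)) = pr w K" and
    m: "\<And>K u. R \<subseteq> {..<u} \<Longrightarrow> (step Y u ^^ m) (pr w (push 0 (index p) K)) = pr v K"
    using Comp.IH by blast
  have "(step Y u ^^ Suc (m + n)) (pr x (push 0 (index (Comp p q)) K)) = pr v K"
    if "Q \<union> R \<subseteq> {..<u}" for K u
  proof (intro funpow_step funpow_chain)
    show "step Y u (pr x (push 0 (index (Comp p q)) K))
      = pr x (push 0 (index q) (push 0 (index p) K))"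
      by (simp add: step_task_def exec_def exec_compound_def mod_Suc div_Suc flip: pr_def)
    show "(step Y u ^^ n) (pr x (push 0 (index q) (push 0 (index p) K)))
      = pr w (push 0 (index p) K)" using n that by simp
    show "(step Y u ^^ m) (pr w (push 0 (index p) K)) = pr v K" using m that by simp
  qed
  then show ?case by blast
next
  case (Rec_0 p a v Q q)
  obtain n where
    n: "\<And>K u. Q \<subseteq> {..<u} \<Longrightarrow> (step Y u ^^ n) (pr a (push 0 (index p) K)) = pr v K"
    using Rec_0.IH by blast
  have "(step Y u ^^ Suc n) (pr (prod_encode (a, 0)) (push 0 (index (Rec p q)) K)) = pr v K"
    if "Q \<subseteq> {..<u}" for K u
  proof (rule funpow_step)
    show "step Y u (pr (prod_encode (a, 0)) (push 0 (index (Rec p q)) K))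
      = pr a (push 0 (index p) K)"
      by (simp add: step_task_def exec_def exec_compound_def mod_Suc div_Suc flip: pr_def)
    show "(step Y u ^^ n) (pr a (push 0 (index p) K)) = pr v K" using n that by simp
  qed
  then show ?case by blast
next
  case (Rec_Suc p q a k w Q v R)
  let ?e = "index (Rec p q)"
  obtain n m where
    n: "\<And>K u. Q \<subseteq> {..<u} \<Longrightarrow> (step Y u ^^ n) (pr (prod_encode (a, k)) (push 0 ?e K)) = pr w K" and
    m: "\<And>K u. R \<subseteq> {..<u} \<Longrightarrow>
      (step Y u ^^ m) (pr (prod_encode (a, prod_encode (k, w))) (push 0 (index q) K)) = pr v K"
    using Rec_Suc.IH by blast
  have "(step Y u ^^ Suc (Suc (Suc m) + n)) (pr (prod_encode (a, Suc k)) (push 0 ?e K)) = pr v K"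
    if "Q \<union> R \<subseteq> {..<u}" for K u
  proof (intro funpow_step funpow_chain)
    let ?K2 = "push 1 a (push 0 (index q) K)"
    let ?K1 = "push 1 k ?K2"
    show "step Y u (pr (prod_encode (a, Suc k)) (push 0 ?e K))
      = pr (prod_encode (a, k)) (push 0 ?e ?K1)"
      by (simp add: step_task_def exec_def exec_compound_def mod_Suc div_Suc flip: pr_def)
    show "(step Y u ^^ n) (pr (prod_encode (a, k)) (push 0 ?e ?K1)) = pr w ?K1"
      using n that by blast
    show "step Y u (pr w ?K1) = pr (prod_encode (k, w)) ?K2"
      by (simp add: step_task_def flip: pr_def)
    show "step Y u (pr (prod_encode (k, w)) ?K2)
      = pr (prod_encode (a, prod_encode (k, w))) (push 0 (index q) K)"
      by (simp add: step_task_def flip: pr_def)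
    show "(step Y u ^^ m) (pr (prod_encode (a, prod_encode (k, w))) (push 0 (index q) K)) = pr v K"
      using m that by blast
  qed
  then show ?case by blast
next
  case (Mu_stop p a k Q)
  let ?x = "prod_encode (a, k)"
  obtain n where
    n: "\<And>K u. Q \<subseteq> {..<u} \<Longrightarrow> (step Y u ^^ n) (pr ?x (push 0 (index p) K)) = pr 0 K"
    using Mu_stop.IH by blast
  have "(step Y u ^^ Suc (1 + n)) (pr ?x (push 0 (index (Mu p)) K)) = pr k K"
    if "Q \<subseteq> {..<u}" for K u
  proof (intro funpow_step funpow_chain)
    show "step Y u (pr ?x (push 0 (index (Mu p)) K))
      = pr ?x (push 0 (index p) (push 3 (pr ?x (index p)) K))"
      by (simp add: step_task_def exec_def exec_compound_def mod_Suc div_Suc)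
    show "(step Y u ^^ n) (pr ?x (push 0 (index p) (push 3 (pr ?x (index p)) K)))
      = pr 0 (push 3 (pr ?x (index p)) K)" using n that by simp
    show "(step Y u ^^ 1) (pr 0 (push 3 (pr ?x (index p)) K)) = pr k K"
      by (simp add: step_task_def flip: pr_def)
  qed
  then show ?case by blast
next
  case (Mu_next p a k w Q v R)
  let ?x = "prod_encode (a, k)" and ?x' = "prod_encode (a, Suc k)"
  obtain n m where
    n: "\<And>K u. Q \<subseteq> {..<u} \<Longrightarrow> (step Y u ^^ n) (pr ?x (push 0 (index p) K)) = pr (Suc w) K" and
    m: "\<And>K u. R \<subseteq> {..<u} \<Longrightarrow> (step Y u ^^ m) (pr ?x' (push 0 (index (Mu p)) K)) = pr v K"
    using Mu_next.IH by blast
  have "(step Y u ^^ Suc (Suc m + n)) (pr ?x (push 0 (index (Mu p)) K)) = pr v K"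
    if "Q \<union> R \<subseteq> {..<u}" for K u
  proof (intro funpow_step funpow_chain)
    show "step Y u (pr ?x (push 0 (index (Mu p)) K))
      = pr ?x (push 0 (index p) (push 3 (pr ?x (index p)) K))"
      by (simp add: step_task_def exec_def exec_compound_def mod_Suc div_Suc)
    show "(step Y u ^^ n) (pr ?x (push 0 (index p) (push 3 (pr ?x (index p)) K)))
      = pr (Suc w) (push 3 (pr ?x (index p)) K)" using n that by simp
    show "step Y u (pr (Suc w) (push 3 (pr ?x (index p)) K)) = pr ?x' (push 0 (index (Mu p)) K)"
      by (simp add: step_task_def flip: pr_def)
    show "(step Y u ^^ m) (pr ?x' (push 0 (index (Mu p)) K)) = pr v K" using m that by blast
  qed
  then show ?case by blast
qed

section \<open>Dependence of the simulation on oracle and bound\<close>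

lemma steps_halted_mono:
  assumes "(step T u ^^ n) c = pr v 0" "n \<le> m"
  shows "(step T u ^^ m) c = pr v 0"
  using funpow_chain[OF assms(1) step_halted, of "m - n"] assms(2) by simp

text \<open>Only a query at or above \<open>u\<close> can separate the two machines; there the first
  one stays put with a nonempty stack and hence never halts.\<close>

lemma step_cong:
  assumes "\<And>y. y < u \<Longrightarrow> y \<in> T \<longleftrightarrow> y \<in> T'"  "u \<le> u'"
  shows "step T u c = step T' u' c \<or> (step T u c = c \<and> pi2 c \<noteq> 0)"
proof (cases "pi2 c = 0 \<or> pi1 (pi1 (pi2 c - 1)) \<noteq> 0 \<or> pi2 (pi1 (pi2 c - 1)) \<noteq> 4 \<or> pi1 c < u")
  case True
  then show ?thesis using assms by (auto simp: step_def step_task_def exec_def)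
next
  case False
  then obtain n where n: "pi2 c = Suc n" by (cases "pi2 c") auto
  then have "pr (pi1 c) (push 0 4 (pi2 n)) = c"
    using False unfolding push_def by (metis diff_Suc_1 pi_pr(3))
  then show ?thesis
    using False by (simp add: step_def step_task_def exec_def n)
qed

lemma steps_cong:
  assumes "\<And>y. y < u \<Longrightarrow> y \<in> T \<longleftrightarrow> y \<in> T'"  "u \<le> u'"
  shows "(step T u ^^ n) c = pr v 0 \<Longrightarrow> (step T' u' ^^ n) c = pr v 0"
proof (induction n arbitrary: c)
  case (Suc n)
  show ?case
  proof (cases "step T u c = step T' u' c")
    case True
    with Suc show ?thesis by (simp add: funpow_swap1)
  next
    case False
    then have stuck: "step T u c = c" "pi2 c \<noteq> 0" using step_cong[OF assms] by blast+
    then have "(step T u ^^ m) c = c" for m by (induction m) auto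
    then show ?thesis using Suc.prems stuck(2) by (metis pi_pr(2))
  qed
qed simp

text \<open>A halting run receives no answer at or above its bound, so the machine with the larger
  bound repeats the run of the other.\<close>

lemma config_unique:
  assumes "config T u e x = pr v 0" "config T' u' e x = pr v' 0"
    and "\<And>y. y < u \<Longrightarrow> y < u' \<Longrightarrow> y \<in> T \<longleftrightarrow> y \<in> T'"
  shows "v = v'"
proof -
  have *: "v = v'" if "u \<le> u'" "config T u e x = pr v 0" "config T' u' e x = pr v' 0"
    "\<And>y. y < u \<Longrightarrow> y < u' \<Longrightarrow> y \<in> T \<longleftrightarrow> y \<in> T'" for T T' u u' v v'
  proof -
    have "(step T' u' ^^ u) (pr x (push 0 e 0)) = pr v 0"
      using that unfolding config_def by (intro steps_cong[of u T T' u']) auto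
    then have "config T' u' e x = pr v 0"
      unfolding config_def using that(1) by (rule steps_halted_mono)
    then show ?thesis using that(3) by simp
  qed
  show ?thesis
  proof (cases "u \<le> u'")
    case True
    then show ?thesis using * assms by blast
  next
    case False
    then show ?thesis using *[of u' u T' v' T v] assms by force
  qed
qed

text \<open>Any bound above the finitely many queries and the number of steps works; thus finitely
  many computations can share one bound.\<close>

lemma run_imp_config:
  assumes "run Y p x v Q"
  shows "\<exists>n. \<forall>u\<ge>n. config (Y \<inter> {..<u}) u (index p) x = pr v 0"
proof -
  obtain n where
    n: "\<And>K u. Q \<subseteq> {..<u} \<Longrightarrow> (step Y u ^^ n) (pr x (push 0 (index p) K)) = pr v K"
    using run_imp_steps[OF assms] by blast
  obtain b where b: "Q \<subseteq> {..<b}"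
    using run_finite_use[OF assms] by (auto simp: finite_nat_set_iff_bounded)
  have "config (Y \<inter> {..<u}) u (index p) x = pr v 0" if "max n b \<le> u" for u
  proof -
    have "(step Y u ^^ n) (pr x (push 0 (index p) 0)) = pr v 0"
      using b that by (intro n) auto
    then have "(step (Y \<inter> {..<u}) u ^^ n) (pr x (push 0 (index p) 0)) = pr v 0"
      by (rule steps_cong[rotated 2]) auto
    then show ?thesis
      unfolding config_def using that by (elim steps_halted_mono) auto
  qed
  then show ?thesis by blast
qed

section \<open>Recursiveness of the simulation\<close>

lemma recursive_push:
  assumes "recursive f" "recursive g" "recursive h"
  shows "recursive (\<lambda>x. push (f x) (g x) (h x))"
  unfolding push_def by (intro recursive_intros assms)

lemma recursive_exec_compound:
  assumes "recursive e" "recursive j" "recursive q" "recursive a" "recursive K"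
  shows "recursive (\<lambda>x. exec_compound (e x) (j x) (q x) (a x) (K x))"
  unfolding exec_compound_def by (intro recursive_intros recursive_push assms)

lemma recursive_exec:
  assumes "recursive t" "recursive u" "recursive e" "recursive a" "recursive K"
  shows "recursive (\<lambda>x. exec (set_decode (t x)) (u x) (e x) (a x) (K x))"
  unfolding exec_def by (intro recursive_intros recursive_push recursive_exec_compound assms)

lemma recursive_step_task:
  assumes "recursive t" "recursive u" "recursive tag" "recursive d" "recursive a" "recursive K"
  shows "recursive (\<lambda>x. step_task (set_decode (t x)) (u x) (tag x) (d x) (a x) (K x))"
  unfolding step_task_def by (intro recursive_intros recursive_push recursive_exec assms)

lemma recursive_step:
  assumes "recursive t" "recursive u" "recursive c"
  shows "recursive (\<lambda>x. step (set_decode (t x)) (u x) (c x))"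
  unfolding step_def by (intro recursive_intros recursive_step_task assms)

lemma recursive_config:
  assumes "recursive t" "recursive u" "recursive e" "recursive y"
  shows "recursive (\<lambda>x. config (set_decode (t x)) (u x) (e x) (y x))"
proof -
  have "(f ^^ n) c = rec_nat c (\<lambda>i. f) n" for f :: "nat \<Rightarrow> nat" and n c
    by (induction n) auto
  then have eq: "(\<lambda>x. config (set_decode (t x)) (u x) (e x) (y x)) =
      (\<lambda>x. rec_nat (pr (y x) (push 0 (e x) 0)) (\<lambda>i. step (set_decode (t x)) (u x)) (u x))"
    by (simp add: config_def)
  show ?thesis
    unfolding eq
    by (intro recursive_rec_nat recursive_step recursive_push recursive_intros assms
      recursive_comp[OF assms(1)] recursive_comp[OF assms(2)])
qed

section \<open>The construction\<close>

text \<open>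
  A stage number is itself the code of the one candidate examined at that stage: the requirement
  \<open>req s\<close>, which is the index of a functional, an oracle \<open>guess s\<close>, a bound on running time and use,
  and a witness.
\<close>
definition req :: "nat \<Rightarrow> nat" where "req s = pi1 s"
definition guess :: "nat \<Rightarrow> nat set" where "guess s = set_decode (pi1 (pi2 s))"
definition use_bound :: "nat \<Rightarrow> nat" where "use_bound s = pi1 (pi2 (pi2 s))"
definition witness :: "nat \<Rightarrow> nat" where "witness s = pr (req s) (pi2 (pi2 (pi2 s)))"

definition state_A :: "nat \<Rightarrow> nat set" where "state_A z = set_decode (pi1 z)"
definition state_B :: "nat \<Rightarrow> nat set" where "state_B z = set_decode (pi1 (pi2 z))"
definition state_acts :: "nat \<Rightarrow> nat set" where "state_acts z = set_decode (pi2 (pi2 z))"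

text \<open>
  Requirement \<open>k\<close> may only decide numbers beyond all stages \<open>t\<close> at which a requirement of higher
  priority acted; the summand \<open>k\<close> in \<open>t + k\<close> leaves one more number undecided for each \<open>k\<close>.
\<close>
definition allowed_at :: "nat \<Rightarrow> nat \<Rightarrow> nat \<Rightarrow> nat \<Rightarrow> bool" where
  "allowed_at z s k y \<longleftrightarrow> k < y \<and> (\<forall>t<s. t \<in> state_acts z \<longrightarrow> req t < k \<longrightarrow> t + k < y)"

text \<open>The bounded quantifier expresses that \<open>y\<close> is at or beyond the least fresh
  number without a minimisation, which makes decidability immediate.\<close>

definition decided_at :: "nat \<Rightarrow> nat \<Rightarrow> nat \<Rightarrow> bool" where
  "decided_at z s y \<longleftrightarrow> y < s \<and> (\<exists>d<Suc y. allowed_at z s (req s) d \<and> d \<in> guess s \<and> d \<notin> state_A z)"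

text \<open>\<open>A\<close> is compared only below \<open>use_bound s\<close>, where queries are
  answered, but \<open>B\<close> throughout, because guessed elements may enter \<open>A\<close>. An
  earlier witness of the same requirement is already in \<open>diag\<close>, hence the output
  1.\<close>

definition acts_at :: "nat \<Rightarrow> nat \<Rightarrow> bool" where
  "acts_at z s \<longleftrightarrow>
    (\<forall>y<use_bound s. y \<in> state_A z \<longrightarrow> y \<in> guess s) \<and> (\<forall>y<s. y \<in> guess s \<longrightarrow> y \<notin> state_B z) \<and>
    (\<forall>t<s. t \<in> state_acts z \<longrightarrow> witness t \<noteq> witness s) \<and>
    (\<forall>t<s. t \<in> state_acts z \<longrightarrow> req t = req s \<longrightarrow> config (guess s) (use_bound s) (req s) (witness t) = pr 1 0) \<and>
    config (guess s) (use_bound s) (req s) (witness s) = pr 0 0"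

text \<open>At or above \<open>use_bound s\<close> the guess may omit elements of \<open>A\<close>;
  these must be kept out of \<open>B\<close> explicitly.\<close>

definition next_state :: "nat \<Rightarrow> nat \<Rightarrow> nat" where
  "next_state s z = (if acts_at z s then
     pr (set_encode {y. y < s \<and> (y \<in> state_A z \<or> decided_at z s y \<and> y \<in> guess s)})
       (pr (set_encode {y. y < s \<and> (y \<in> state_B z \<or> decided_at z s y \<and> y \<notin> guess s \<and> y \<notin> state_A z)})
         (set_encode {t. t < Suc s \<and> (t \<in> state_acts z \<or> t = s)}))
     else z)"

definition state :: "nat \<Rightarrow> nat" where "state = rec_nat 0 next_state"

definition A_stage :: "nat \<Rightarrow> nat set" where "A_stage s = state_A (state s)"
definition B_stage :: "nat \<Rightarrow> nat set" where "B_stage s = state_B (state s)"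
definition acts :: "nat \<Rightarrow> bool" where "acts s \<longleftrightarrow> acts_at (state s) s"

definition allowed :: "nat \<Rightarrow> nat \<Rightarrow> nat \<Rightarrow> bool" where
  "allowed s k y \<longleftrightarrow> k < y \<and> (\<forall>t<s. acts t \<longrightarrow> req t < k \<longrightarrow> t + k < y)"

definition fresh :: "nat \<Rightarrow> nat \<Rightarrow> bool" where
  "fresh s d \<longleftrightarrow> allowed s (req s) d \<and> d \<in> guess s \<and> d \<notin> A_stage s"

text \<open>If nothing is fresh the value is \<open>s\<close>, so that the interval decided at stage
  \<open>s\<close> is empty.\<close>

definition first_fresh :: "nat \<Rightarrow> nat" where
  "first_fresh s = (LEAST d. s \<le> d \<or> fresh s d)"

section \<open>The stages of the construction\<close>

lemma mem_decode_less: "y \<in> set_decode n \<Longrightarrow> y < n"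
proof -
  assume "y \<in> set_decode n"
  then have "odd (n div 2 ^ y)" by (simp add: set_decode_def)
  then have "n div 2 ^ y \<noteq> 0" by (metis even_zero)
  then have "2 ^ y \<le> n" by (simp add: div_eq_0_iff)
  then show "y < n" using less_exp[of y] by linarith
qed

lemma guess_less: "y \<in> guess s \<Longrightarrow> y < s"
  unfolding guess_def using mem_decode_less pi_le le_trans less_le_trans by metis

lemma use_bound_le: "use_bound s \<le> s"
  unfolding use_bound_def using pi_le le_trans by metis

lemma state_Suc: "state (Suc s) = next_state s (state s)"
  by (simp add: state_def)

lemma next_state_active:
  assumes "acts_at z s"
  shows "state_A (next_state s z) = {y. y < s \<and> (y \<in> state_A z \<or> decided_at z s y \<and> y \<in> guess s)}"
    and "state_B (next_state s z)
      = {y. y < s \<and> (y \<in> state_B z \<or> decided_at z s y \<and> y \<notin> guess s \<and> y \<notin> state_A z)}"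
    and "state_acts (next_state s z) = {t. t < Suc s \<and> (t \<in> state_acts z \<or> t = s)}"
  using assms unfolding next_state_def by (auto simp: state_A_def state_B_def state_acts_def set_encode_inverse)

lemma next_state_inactive: "\<not> acts_at z s \<Longrightarrow> next_state s z = z"
  by (simp add: next_state_def)

lemma state_A_B_less: "state_A (state s) \<subseteq> {..<s}" "state_B (state s) \<subseteq> {..<s}"
proof (induction s)
  case 0
  have "pi1 0 = 0" "pi2 0 = 0" by (rule pi_le[of 0, simplified])+
  then show "state_A (state 0) \<subseteq> {..<0}" "state_B (state 0) \<subseteq> {..<0}"
    by (simp_all add: state_def state_A_def state_B_def)
next
  case (Suc s)
  show "state_A (state (Suc s)) \<subseteq> {..<Suc s}"
    using Suc by (cases "acts_at (state s) s")
      (auto simp: state_Suc next_state_active next_state_inactive)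
  show "state_B (state (Suc s)) \<subseteq> {..<Suc s}"
    using Suc by (cases "acts_at (state s) s")
      (auto simp: state_Suc next_state_active next_state_inactive)
qed

lemma state_acts_eq: "state_acts (state s) = {t. t < s \<and> acts t}"
proof (induction s)
  case 0
  have "pi2 0 = 0" by (rule pi_le[of 0, simplified])
  then show ?case by (simp add: state_def state_acts_def)
next
  case (Suc s)
  then show ?case
    by (cases "acts s") (auto simp: state_Suc acts_def next_state_active less_Suc_eq next_state_inactive)
qed

lemma allowed_at_state: "allowed_at (state s) s k y \<longleftrightarrow> allowed s k y"
  by (auto simp: allowed_at_def allowed_def state_acts_eq)

lemma fresh_first_fresh: "first_fresh s < s \<Longrightarrow> fresh s (first_fresh s)"
  using LeastI[of "\<lambda>d. s \<le> d \<or> fresh s d" s] unfolding first_fresh_def by auto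

lemma first_fresh_le_fresh: "fresh s d \<Longrightarrow> first_fresh s \<le> d"
  unfolding first_fresh_def by (rule Least_le) simp

lemma decided_at_state: "decided_at (state s) s y \<longleftrightarrow> first_fresh s \<le> y \<and> y < s"
proof -
  have "decided_at (state s) s y \<longleftrightarrow> y < s \<and> (\<exists>d\<le>y. fresh s d)"
    by (auto simp: decided_at_def allowed_at_state fresh_def A_stage_def less_Suc_eq_le)
  also have "\<dots> \<longleftrightarrow> first_fresh s \<le> y \<and> y < s"
    using fresh_first_fresh[of s] first_fresh_le_fresh[of s] le_trans le_less_trans by blast
  finally show ?thesis .
qed

lemma A_stage_0: "A_stage 0 = {}" and B_stage_0: "B_stage 0 = {}"
  using state_A_B_less[of 0] by (auto simp: A_stage_def B_stage_def)

lemma A_stage_Suc: "A_stage (Suc s) = (if acts s then A_stage s \<union> ({first_fresh s..<s} \<inter> guess s) else A_stage s)"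
  using state_A_B_less(1)[of s]
  by (cases "acts s") (auto simp: A_stage_def state_Suc acts_def next_state_active decided_at_state
    next_state_inactive)

lemma B_stage_Suc: "B_stage (Suc s) = (if acts s then B_stage s \<union> ({first_fresh s..<s} - guess s - A_stage s) else B_stage s)"
  using state_A_B_less(2)[of s]
  by (cases "acts s") (auto simp: A_stage_def B_stage_def state_Suc acts_def next_state_active decided_at_state
    next_state_inactive)

lemma acts_iff:
  "acts s \<longleftrightarrow> A_stage s \<inter> {..<use_bound s} \<subseteq> guess s \<and> guess s \<inter> B_stage s = {} \<and>
    (\<forall>t<s. acts t \<longrightarrow> witness t \<noteq> witness s) \<and>
    (\<forall>t<s. acts t \<longrightarrow> req t = req s \<longrightarrow> config (guess s) (use_bound s) (req s) (witness t) = pr 1 0) \<and>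
    config (guess s) (use_bound s) (req s) (witness s) = pr 0 0"
proof -
  have "(\<forall>y<s. y \<in> guess s \<longrightarrow> y \<notin> B_stage s) \<longleftrightarrow> guess s \<inter> B_stage s = {}"
    using guess_less by blast
  moreover have "(\<forall>y<use_bound s. y \<in> A_stage s \<longrightarrow> y \<in> guess s) \<longleftrightarrow> A_stage s \<inter> {..<use_bound s} \<subseteq> guess s" by auto
  ultimately show ?thesis
    unfolding acts_def[of s] acts_at_def by (simp add: state_acts_eq flip: A_stage_def B_stage_def)
qed

lemma A_guess: "acts s \<Longrightarrow> A_stage s \<inter> {..<use_bound s} \<subseteq> guess s"
  and B_guess: "acts s \<Longrightarrow> guess s \<inter> B_stage s = {}"
  and config_witness: "acts s \<Longrightarrow> config (guess s) (use_bound s) (req s) (witness s) = pr 0 0"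
  by (drule acts_iff[THEN iffD1]; elim conjE; assumption)+

lemma config_earlier_witness:
  assumes "acts s" "acts t" "t < s" "req t = req s"
  shows "config (guess s) (use_bound s) (req s) (witness t) = pr 1 0"
proof -
  have "\<forall>t<s. acts t \<longrightarrow> req t = req s \<longrightarrow> config (guess s) (use_bound s) (req s) (witness t) = pr 1 0"
    using assms(1) by (rule acts_iff[THEN iffD1, elim_format]) (elim conjE)
  then show ?thesis using assms by simp
qed

lemma A_stage_mono: "s \<le> t \<Longrightarrow> A_stage s \<subseteq> A_stage t"
  by (rule lift_Suc_mono_le[of A_stage]) (auto simp: A_stage_Suc)

lemma B_stage_mono: "s \<le> t \<Longrightarrow> B_stage s \<subseteq> B_stage t"
  by (rule lift_Suc_mono_le[of B_stage]) (auto simp: B_stage_Suc)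

text \<open>New elements of \<open>A\<close> lie in the guess, which misses the old
  \<open>B\<close>; new elements of \<open>B\<close> lie outside the guess and the old
  \<open>A\<close>.\<close>

lemma A_B_stage_disjoint: "A_stage s \<inter> B_stage s = {}"
proof (induction s)
  case (Suc s)
  then show ?case using B_guess[of s] by (auto simp: A_stage_Suc B_stage_Suc)
qed (simp add: A_stage_0)

section \<open>Each requirement acts finitely often\<close>

lemma A_stage_unchanged:
  assumes "s \<le> t" "\<And>l. s \<le> l \<Longrightarrow> l < t \<Longrightarrow> acts l \<Longrightarrow> y < first_fresh l"
  shows "y \<in> A_stage t \<longleftrightarrow> y \<in> A_stage s"
  using assms by (induction t rule: dec_induct) (force simp: A_stage_Suc)+

text \<open>
  Up to \<open>first_fresh n\<close> both guesses equal \<open>A\<close>, and between \<open>first_fresh n\<close> and \<open>n\<close> everything was decided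
  according to \<open>guess n\<close>; so both guesses give the same value at the witness of \<open>n\<close>, although that
  witness has meanwhile entered \<open>diag\<close>.
\<close>
lemma acts_conflict:
  assumes n: "acts n" "req n = k" and n': "acts n'" "req n' = k" and less: "n < n'"
    and higher: "\<And>l. n \<le> l \<Longrightarrow> l < n' \<Longrightarrow> acts l \<Longrightarrow> k \<le> req l"
    and first_fresh: "\<And>l. n < l \<Longrightarrow> l \<le> n' \<Longrightarrow> acts l \<Longrightarrow> req l = k \<Longrightarrow> first_fresh n \<le> first_fresh l"
    and protected: "\<And>y. \<not> allowed n k y \<Longrightarrow> y \<in> guess n \<longleftrightarrow> y \<in> guess n'"
  shows False
proof -
  \<comment> \<open>No higher priority acts from \<open>n\<close> until \<open>n'\<close>, so both
    stages obey the same restraint.\<close>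
  have allowed: "allowed n' k y \<longleftrightarrow> allowed n k y" for y
  proof -
    have "t < n' \<and> acts t \<and> req t < k \<longleftrightarrow> t < n \<and> acts t \<and> req t < k" for t
      using less higher[of t] by (cases "n \<le> t") auto
    then show ?thesis unfolding allowed_def by blast
  qed
  have "y \<in> guess n \<longleftrightarrow> y \<in> guess n'" if y: "y < use_bound n" "y < use_bound n'" for y
  proof -
    have "y < n" using y use_bound_le[of n] by simp
    consider "\<not> allowed n k y" | "allowed n k y" "y < first_fresh n" | "first_fresh n \<le> y" by linarith
    then show ?thesis
    proof cases
      case 1
      then show ?thesis by (rule protected)
    next
      case 2
      have "y < first_fresh l" if l: "n \<le> l" "l < n'" "acts l" for l
      proof (cases "l = n \<or> req l = k")
        case True
        then show ?thesis using 2 first_fresh[of l] l by fastforce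
      next
        case False
        then have "k < req l" "n < l" using higher l by (auto simp: le_less)
        show ?thesis
        proof (cases "first_fresh l < l")
          case True
          \<comment> \<open>The act at \<open>n\<close> restrains the lower priority
            \<open>req l\<close> from all numbers up to \<open>n + req l\<close>.\<close>
          then have "n + req l < first_fresh l"
            using fresh_first_fresh[of l] \<open>k < req l\<close> \<open>n < l\<close> n by (auto simp: fresh_def allowed_def)
          then show ?thesis using \<open>y < n\<close> by simp
        next
          case False
          then show ?thesis using \<open>y < n\<close> \<open>n < l\<close> by simp
        qed
      qed
      then have "y \<in> A_stage n' \<longleftrightarrow> y \<in> A_stage n"
        using less by (intro A_stage_unchanged) auto
      \<comment> \<open>An allowed number below \<open>first_fresh n\<close> is not fresh, so it is
        guessed only if already in \<open>A\<close>; the converse holds below the use bound.\<close>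
      moreover have "y \<in> guess n \<longleftrightarrow> y \<in> A_stage n"
        using 2 y n first_fresh_le_fresh[of n y] A_guess[of n] by (auto simp: fresh_def)
      moreover have "first_fresh n \<le> first_fresh n'" using first_fresh n' less by simp
      then have "y \<in> guess n' \<longleftrightarrow> y \<in> A_stage n'"
        using 2 y n' first_fresh_le_fresh[of n' y] A_guess[of n'] by (auto simp: fresh_def allowed)
      ultimately show ?thesis by simp
    next
      case 3
      have "A_stage (Suc n) \<subseteq> A_stage n'" "B_stage (Suc n) \<subseteq> B_stage n'"
        using less by (auto intro!: A_stage_mono B_stage_mono simp: Suc_le_eq del: subsetI)
      moreover have "y \<in> A_stage n \<longrightarrow> y \<in> guess n" using n y A_guess[of n] by auto
      ultimately show ?thesis
        using 3 \<open>y < n\<close> n y A_guess[OF n'(1)] B_guess[OF n'(1)] by (auto simp: A_stage_Suc B_stage_Suc)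
    qed
  qed
  then have agree: "y < use_bound n \<Longrightarrow> y < use_bound n' \<Longrightarrow> y \<in> guess n \<longleftrightarrow> y \<in> guess n'" for y .
  have "config (guess n) (use_bound n) k (witness n) = pr 0 0"
    using config_witness[OF n(1)] n(2) by simp
  moreover have "config (guess n') (use_bound n') k (witness n) = pr 1 0"
    using config_earlier_witness[OF n'(1) n(1) less] n n' by simp
  ultimately have "(0::nat) = 1" using agree by (rule config_unique)
  then show False by simp
qed

lemma finite_acts: "finite {s. acts s \<and> req s = k}"
proof (induction k rule: less_induct)
  case (less k)
  define S where "S = {s. acts s \<and> req s = k}"
  have "{s. acts s \<and> req s < k} = (\<Union>j<k. {s. acts s \<and> req s = j})" by auto
  then have "finite {s. acts s \<and> req s < k}" using less by auto
  then obtain b where b: "\<And>s. acts s \<Longrightarrow> req s < k \<Longrightarrow> s < b"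
    unfolding finite_nat_set_iff_bounded by auto
  show ?case
  proof (rule ccontr)
    assume "infinite {s. acts s \<and> req s = k}"
    then have inf: "infinite S" by (simp add: S_def)
    \<comment> \<open>As in Dekker's true stages, infinitely many acts are never undercut later.\<close>
    define R where "R = {n \<in> S. b \<le> n \<and> (\<forall>l\<in>S. n < l \<longrightarrow> first_fresh n \<le> first_fresh l)}"
    have "\<exists>n\<ge>m. n \<in> R" for m
    proof -
      obtain n0 where "n0 \<in> S" "max m b \<le> n0"
        using inf unfolding infinite_nat_iff_unbounded_le by blast
      \<comment> \<open>An act minimising \<open>first_fresh\<close> beyond \<open>max m b\<close>
        is not undercut later.\<close>
      then obtain n where "n \<in> S \<and> max m b \<le> n"
        "\<And>l. l \<in> S \<and> max m b \<le> l \<Longrightarrow> first_fresh n \<le> first_fresh l"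
        using ex_has_least_nat[of "\<lambda>n. n \<in> S \<and> max m b \<le> n" n0 first_fresh] by blast
      then show ?thesis unfolding R_def by auto
    qed
    then have "infinite R" unfolding infinite_nat_iff_unbounded_le by blast
    \<comment> \<open>Restrained numbers are at most \<open>k\<close>, or at most
      \<open>t + k\<close> for an act \<open>t < b\<close>. Hence the trace on
      \<open>{..b + k}\<close> contains all of them, and there are only finitely many
      traces.\<close>
    moreover define f where "f n = guess n \<inter> {..b + k}" for n
    have "f ` R \<subseteq> Pow {..b + k}" by (auto simp: f_def)
    then have "finite (f ` R)" by (rule finite_subset) simp
    ultimately obtain n where "n \<in> R" and "infinite {n' \<in> R. f n' = f n}"
      using pigeonhole_infinite[of R f] by blast
    then obtain n' where n': "n' \<in> R" "f n' = f n" "n < n'"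
      unfolding infinite_nat_iff_unbounded by blast
    show False
    proof (rule acts_conflict[of n k n'])
      show "acts n" "req n = k" "acts n'" "req n' = k" "n < n'"
        using \<open>n \<in> R\<close> n' by (auto simp: R_def S_def)
      show "k \<le> req l" if "n \<le> l" "l < n'" "acts l" for l
        using that b[of l] \<open>n \<in> R\<close> by (force simp: R_def)
      show "first_fresh n \<le> first_fresh l" if "n < l" "l \<le> n'" "acts l" "req l = k" for l
        using that \<open>n \<in> R\<close> by (simp add: R_def S_def)
      show "y \<in> guess n \<longleftrightarrow> y \<in> guess n'" if "\<not> allowed n k y" for y
      proof -
        have "y \<le> b + k" using that b by (fastforce simp: allowed_def)
        then show ?thesis using n'(2) by (auto simp: f_def)
      qed
    qed
  qed
qed

section \<open>The limit sets and their separators\<close>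

definition A_lim :: "nat set" where "A_lim = (\<Union>s. A_stage s)"
definition B_lim :: "nat set" where "B_lim = (\<Union>s. B_stage s)"
definition diag :: "nat set" where "diag = {witness s |s. acts s}"

lemma lim_disjoint: "A_lim \<inter> B_lim = {}"
proof -
  have "x \<notin> B_stage t" if "x \<in> A_stage s" for x s t
    using that A_stage_mono[of s "max s t"] B_stage_mono[of t "max s t"] A_B_stage_disjoint[of "max s t"] by auto
  then show ?thesis by (auto simp: A_lim_def B_lim_def)
qed

lemma stage_member_decided:
  assumes "y \<in> A_stage s \<union> B_stage s"
  obtains t where "acts t" "first_fresh t \<le> y" "y < t"
  using assms by (induction s) (auto simp: A_stage_0 B_stage_0 A_stage_Suc B_stage_Suc split: if_splits)

text \<open>With \<open>M\<close> bounding the acts of requirements below \<open>k\<close>, the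
  number \<open>k + M\<close> stays undecided: acts up to stage \<open>k + M\<close> decide only
  smaller numbers, and later ones belong to requirements restrained beyond it.\<close>

lemma infinite_undecided: "infinite (UNIV - (A_lim \<union> B_lim))"
proof -
  have "\<exists>y\<ge>k. y \<notin> A_lim \<union> B_lim" for k
  proof -
    define E where "E = {s. acts s \<and> req s < k}"
    have "E = (\<Union>j<k. {s. acts s \<and> req s = j})" by (auto simp: E_def)
    then have fin: "finite E" using finite_acts by auto
    \<comment> \<open>If there is no such act, \<open>M\<close> is 0 and the clause
      \<open>k < y\<close> of \<open>allowed\<close> suffices.\<close>
    define M where "M = (if E = {} then 0 else Max E)"
    have M: "s \<le> M" if "acts s" "req s < k" for s
      using that fin by (auto simp: M_def E_def)
    have M': "M = 0 \<or> acts M \<and> req M < k"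
      using Max_in[OF fin] by (auto simp: M_def E_def)
    have "\<not> first_fresh t \<le> k + M \<or> t \<le> k + M" if "acts t" for t
    proof (rule ccontr)
      assume "\<not> (\<not> first_fresh t \<le> k + M \<or> t \<le> k + M)"
      then have t: "first_fresh t \<le> k + M" "k + M < t" by auto
      then have allowed: "allowed t (req t) (first_fresh t)"
        using fresh_first_fresh[of t] by (auto simp: fresh_def)
      have "k \<le> req t" using M[OF that] t by (cases "req t < k") auto
      from M' show False
      proof
        assume "M = 0"
        then show False using allowed t \<open>k \<le> req t\<close> by (simp add: allowed_def)
      next
        assume "acts M \<and> req M < k"
        moreover have "M < t" using t by simp
        ultimately have "M + req t < first_fresh t"
          using allowed \<open>k \<le> req t\<close> unfolding allowed_def by (meson less_le_trans)
        then show False using t \<open>k \<le> req t\<close> by simp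
      qed
    qed
    then have "k + M \<notin> A_stage s \<union> B_stage s" for s by (metis stage_member_decided linorder_not_le)
    then show ?thesis by (intro exI[of _ "k + M"]) (auto simp: A_lim_def B_lim_def)
  qed
  then show ?thesis unfolding infinite_nat_iff_unbounded_le by auto
qed

lemma separator_not_compute_diag:
  assumes sep: "separator A_lim B_lim Z"
  shows "\<not> diag \<le>\<^sub>T Z"
proof
  assume "diag \<le>\<^sub>T Z"
  then obtain p where p: "\<And>x. \<exists>Q. run Z p x (of_bool (x \<in> diag)) Q"
    unfolding turing_le_def by blast
  define k where "k = index p"
  define E where "E = {s. acts s \<and> req s = k}"
  have fin: "finite (witness ` E)" unfolding E_def using finite_acts by simp
  have "infinite (range (pr k))" by (rule range_inj_infinite) (simp add: inj_def)
  then obtain x where x: "x \<in> range (pr k)" "x \<notin> witness ` E"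
    using fin by (meson finite_subset subsetI)
  then have pi1_x: "pi1 x = k" by auto
  \<comment> \<open>A witness carries its requirement as first component, so only acts of
    \<open>k\<close> could put \<open>x\<close> into \<open>diag\<close>.\<close>
  then have "x \<notin> diag" using x by (auto simp: diag_def E_def witness_def)
  have "\<forall>y. \<exists>n. \<forall>u\<ge>n. config (Z \<inter> {..<u}) u k y = pr (of_bool (y \<in> diag)) 0"
    unfolding k_def using p run_imp_config by blast
  then obtain n where n: "\<And>y u. n y \<le> u \<Longrightarrow>
    config (Z \<inter> {..<u}) u k y = pr (of_bool (y \<in> diag)) 0" by metis
  define u where "u = Max (n ` insert x (witness ` E))"
  have u: "n y \<le> u" if "y \<in> insert x (witness ` E)" for y
    unfolding u_def using that fin by (intro Max_ge) auto
  \<comment> \<open>This stage codes a true initial segment of \<open>Z\<close>, long enough for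
    \<open>x\<close> and all witnesses of \<open>k\<close>; hence it must act and put
    \<open>x\<close> into \<open>diag\<close>.\<close>
  define s where "s = pr k (pr (set_encode (Z \<inter> {..<u})) (pr u (pi2 x)))"
  have s: "req s = k" "guess s = Z \<inter> {..<u}" "use_bound s = u" "witness s = x"
    unfolding s_def req_def guess_def use_bound_def witness_def using pi1_x
    by (auto simp: set_encode_inverse)
  have "acts s"
  proof (subst acts_iff, intro conjI allI impI)
    show "A_stage s \<inter> {..<use_bound s} \<subseteq> guess s"
      using sep by (auto simp: s separator_def A_lim_def)
    show "guess s \<inter> B_stage s = {}"
      using sep by (auto simp: s separator_def B_lim_def)
    show "witness t \<noteq> witness s" if "acts t" for t
      using that \<open>x \<notin> diag\<close> by (auto simp: s diag_def)
    show "config (guess s) (use_bound s) (req s) (witness t) = pr 1 0" if "acts t" "req t = req s" for t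
      using that n[OF u, of "witness t"] by (auto simp: s E_def diag_def)
    show "config (guess s) (use_bound s) (req s) (witness s) = pr 0 0"
      using n[OF u, of x] \<open>x \<notin> diag\<close> by (simp add: s)
  qed
  then show False using \<open>x \<notin> diag\<close> s by (auto simp: diag_def)
qed

section \<open>Effectivity of the construction\<close>

text \<open>A bound \<open>U\<close> on the queries of every single test bounds the whole search,
  however long it runs; the wtt reduction relies on this.\<close>

lemma run_Mu_exists:
  assumes test: "\<And>m. \<exists>Q\<subseteq>U. run Y q (pr a m) (of_bool (\<not> P m)) Q"
    and "P n" "m \<le> n"
  shows "\<exists>n' Q. P n' \<and> Q \<subseteq> U \<and> run Y (Mu q) (pr a m) n' Q"
  using assms(3)
proof (induction m rule: inc_induct)
  case base
  then show ?case
    using test[of n] \<open>P n\<close> run.Mu_stop[of Y q a n] by (auto simp: pr_def)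
next
  case (step m)
  obtain Q where Q: "Q \<subseteq> U" "run Y q (pr a m) (of_bool (\<not> P m)) Q"
    using test by blast
  show ?case
  proof (cases "P m")
    case True
    then show ?thesis using Q run.Mu_stop[of Y q a m Q] by (auto simp: pr_def)
  next
    case False
    obtain n' R where "P n'" "R \<subseteq> U" "run Y (Mu q) (pr a (Suc m)) n' R"
      using step.IH by blast
    moreover have "run Y q (pr a m) (Suc 0) Q" using Q False by simp
    ultimately have "P n' \<and> Q \<union> R \<subseteq> U \<and> run Y (Mu q) (pr a m) n' (Q \<union> R)"
      using run.Mu_next[of Y q a m 0 Q n' R] Q by (simp add: pr_def)
    then show ?thesis by blast
  qed
qed

lemma run_Mu_value:
  assumes test: "\<And>m. \<exists>Q. run Y q (pr a m) (of_bool (\<not> P m)) Q"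
    and "run Y (Mu q) (pr a m) n Q"
  shows "P n"
proof -
  have "P n" if "run Y r z n Q" "r = Mu q" "z = pr a m" for r z n Q m
    using that
  proof (induction arbitrary: m rule: run.induct)
    case (Mu_stop p b k Q)
    then have "run Y q (pr a k) 0 Q" by (simp add: pr_def)
    moreover obtain R where "run Y q (pr a k) (of_bool (\<not> P k)) R" using test by blast
    ultimately have "0 = (of_bool (\<not> P k) :: nat)" using run_deterministic by blast
    then show ?case by (simp split: if_splits)
  next
    case (Mu_next p b k w Q n R)
    then show ?case by (simp add: pr_def)
  qed auto
  then show ?thesis using assms(2) by blast
qed

lemma halts_Comp:
  assumes "run Y q x u Q"
  shows "halts Y (Comp p q) x \<longleftrightarrow> halts Y p u"
proof
  assume "halts Y (Comp p q) x"
  then obtain v R where "run Y (Comp p q) x v R" unfolding halts_def by blast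
  then show "halts Y p u"
  proof (rule run_cases(7))
    fix u' Q' R'
    assume "run Y q x u' Q'" "run Y p u' v R'"
    moreover have "u' = u" using run_deterministic[OF \<open>run Y q x u' Q'\<close> assms] by simp
    ultimately show "halts Y p u" unfolding halts_def by blast
  qed
next
  assume "halts Y p u"
  then show "halts Y (Comp p q) x"
    unfolding halts_def using run.Comp[OF assms] by blast
qed

lemma halts_search:
  assumes "decidable (\<lambda>z. P (pi1 z) (pi2 z))"
  obtains p where "\<And>Y x. halts Y p x \<longleftrightarrow> (\<exists>s. P x s)"
proof -
  have "decidable (\<lambda>z. \<not> P (pi1 z) (pi2 z))" using assms by (rule decidable_not)
  then obtain q where q: "\<And>Y z. run Y q z (of_bool (\<not> P (pi1 z) (pi2 z))) {}"
    unfolding decidable_def recursive_def by metis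
  have test: "run Y q (pr x m) (of_bool (\<not> P x m)) {}" for Y x m
    using q[of Y "pr x m"] by simp
  have input: "run Y (Pairing (Pairing First Second) Zero) x (pr x 0) {}" for Y x
    by (intro run_Pairing0 run_id run.Zero)
  define p where "p = Comp (Mu q) (Pairing (Pairing First Second) Zero)"
  have "halts Y p x \<longleftrightarrow> (\<exists>s. P x s)" for Y x
    unfolding p_def halts_Comp[OF input]
  proof
    assume "halts Y (Mu q) (pr x 0)"
    then obtain v R where "run Y (Mu q) (pr x 0) v R" unfolding halts_def by blast
    then have "P x v" by (rule run_Mu_value[rotated]) (rule exI, rule test)
    then show "\<exists>s. P x s" ..
  next
    assume "\<exists>s. P x s"
    then obtain s where "P x s" ..
    moreover have "\<exists>Q\<subseteq>{}. run Y q (pr x m) (of_bool (\<not> P x m)) Q" for m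
      using test[of Y x m] by blast
    ultimately obtain n Q where "run Y (Mu q) (pr x 0) n Q"
      using run_Mu_exists[of "{}" Y q x "P x" s 0] by auto
    then show "halts Y (Mu q) (pr x 0)" unfolding halts_def by blast
  qed
  then show ?thesis by (rule that)
qed

lemma ce_search:
  assumes "decidable (\<lambda>z. P (pi1 z) (pi2 z))"
  shows "ce {x. \<exists>s. P x s}"
proof -
  obtain p where "\<And>x. halts {} p x \<longleftrightarrow> (\<exists>s. P x s)"
    using halts_search[OF assms] by metis
  then have "{x. \<exists>s. P x s} = {x. halts {} p x}" by simp
  then show ?thesis unfolding ce_def by blast
qed

section \<open>Recursiveness of the construction and enumerability of the limit sets\<close>

lemma recursive_guess_parts:
  assumes "recursive s"
  shows "recursive (\<lambda>x. req (s x))" "recursive (\<lambda>x. use_bound (s x))" "recursive (\<lambda>x. witness (s x))"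
  unfolding req_def use_bound_def witness_def by (intro recursive_intros assms)+

lemma decidable_guess:
  "recursive f \<Longrightarrow> recursive s \<Longrightarrow> decidable (\<lambda>x. f x \<in> guess (s x))"
  unfolding guess_def by (intro recursive_intros)

lemma decidable_state:
  assumes "recursive f" "recursive z"
  shows "decidable (\<lambda>x. f x \<in> state_A (z x))" "decidable (\<lambda>x. f x \<in> state_B (z x))"
    "decidable (\<lambda>x. f x \<in> state_acts (z x))"
  unfolding state_A_def state_B_def state_acts_def by (intro recursive_intros assms)+

lemma recursive_config_guess:
  assumes "recursive s" "recursive u" "recursive e" "recursive y"
  shows "recursive (\<lambda>x. config (guess (s x)) (u x) (e x) (y x))"
  unfolding guess_def by (intro recursive_config recursive_intros assms)

lemmas stage_intros = recursive_guess_parts decidable_guess decidable_state recursive_config_guess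

lemma decidable_allowed_at:
  assumes "recursive z" "recursive s" "recursive k" "recursive y"
  shows "decidable (\<lambda>x. allowed_at (z x) (s x) (k x) (y x))"
  unfolding allowed_at_def
  by (intro recursive_intros stage_intros assms recursive_comp[OF assms(1)]
    recursive_comp[OF assms(3)] recursive_comp[OF assms(4)])

lemma decidable_decided_at:
  assumes "recursive z" "recursive s" "recursive y"
  shows "decidable (\<lambda>x. decided_at (z x) (s x) (y x))"
  unfolding decided_at_def
  by (intro recursive_intros stage_intros decidable_allowed_at assms recursive_comp[OF assms(1)]
    recursive_comp[OF assms(2)])

lemma decidable_acts_at:
  assumes "recursive z" "recursive s"
  shows "decidable (\<lambda>x. acts_at (z x) (s x))"
  unfolding acts_at_def
  by (intro recursive_intros stage_intros assms recursive_comp[OF assms(1)]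
    recursive_comp[OF assms(2)])

lemma recursive_next_state:
  assumes "recursive z" "recursive s"
  shows "recursive (\<lambda>x. next_state (s x) (z x))"
  unfolding next_state_def
  by (intro recursive_intros stage_intros decidable_acts_at decidable_decided_at assms
    recursive_comp[OF assms(1)] recursive_comp[OF assms(2)])

lemma recursive_state: "recursive s \<Longrightarrow> recursive (\<lambda>x. state (s x))"
  unfolding state_def by (intro recursive_rec_nat recursive_next_state recursive_intros)

lemma decidable_A_stage: "recursive f \<Longrightarrow> recursive s \<Longrightarrow> decidable (\<lambda>x. f x \<in> A_stage (s x))"
  and decidable_B_stage: "recursive f \<Longrightarrow> recursive s \<Longrightarrow> decidable (\<lambda>x. f x \<in> B_stage (s x))"
  and decidable_acts: "recursive s \<Longrightarrow> decidable (\<lambda>x. acts (s x))"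
  unfolding A_stage_def B_stage_def acts_def
  by (intro decidable_state decidable_acts_at recursive_state, assumption+)+

lemma ce_A_lim: "ce A_lim"
proof -
  have "A_lim = {x. \<exists>s. x \<in> A_stage s}" by (auto simp: A_lim_def)
  moreover have "decidable (\<lambda>z. pi1 z \<in> A_stage (pi2 z))" by (intro decidable_A_stage recursive_intros)
  then have "ce {x. \<exists>s. x \<in> A_stage s}" by (rule ce_search)
  ultimately show ?thesis by simp
qed

lemma ce_B_lim: "ce B_lim"
proof -
  have "B_lim = {x. \<exists>s. x \<in> B_stage s}" by (auto simp: B_lim_def)
  moreover have "decidable (\<lambda>z. pi1 z \<in> B_stage (pi2 z))" by (intro decidable_B_stage recursive_intros)
  then have "ce {x. \<exists>s. x \<in> B_stage s}" by (rule ce_search)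
  ultimately show ?thesis by simp
qed

section \<open>Reduction of \<open>diag\<close> to the halting set\<close>

primrec const_prog :: "nat \<Rightarrow> prog" where
  "const_prog 0 = Zero"
| "const_prog (Suc n) = Comp Succ (const_prog n)"

lemma run_const_prog: "run Y (const_prog n) x n {}"
  by (induction n) (auto intro: run.Zero run_Comp0 run.Succ)

text \<open>
  A many-one reduction is composed with a Turing reduction by \<open>Comp\<close>, without simulating one oracle
  by another.
\<close>
lemma search_many_one_halting:
  assumes "decidable (\<lambda>z. P (pi1 z) (pi2 z))"
  shows "\<exists>h. recursive h \<and> (\<forall>x. h x \<in> halting_set \<longleftrightarrow> (\<exists>s. P x s))"
proof -
  obtain p where p: "\<And>Y x. halts Y p x \<longleftrightarrow> (\<exists>s. P x s)"
    using halts_search[OF assms] by blast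
  \<comment> \<open>This program ignores its input and runs \<open>p\<close> on \<open>x\<close>, so
    running it on its own index decides nothing but the search for \<open>x\<close>.\<close>
  define h where "h x = index (Comp p (const_prog x))" for x
  have "index (const_prog x) = rec_nat 0 (\<lambda>i u. 6 + 4 * pr 1 u) x" for x
    by (induction x) (simp_all add: pr_def)
  then have "h = (\<lambda>x. 6 + 4 * pr (index p) (rec_nat 0 (\<lambda>i u. 6 + 4 * pr 1 u) x))"
    by (auto simp: h_def pr_def)
  moreover have "recursive \<dots>"
    by (intro recursive_rec_nat recursive_intros)
  ultimately have "recursive h" by simp
  moreover have "h x \<in> halting_set \<longleftrightarrow> (\<exists>s. P x s)" for x
  proof -
    have "h x \<in> halting_set \<longleftrightarrow> halts {} (Comp p (const_prog x)) (h x)"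
      unfolding jump_def h_def using bij_is_inj[OF bij_index] by (blast dest: injD)
    then show ?thesis by (simp add: halts_Comp[OF run_const_prog] p)
  qed
  ultimately show ?thesis by blast
qed

lemma halting_le_imp_diag_le:
  assumes "halting_set \<le>\<^sub>T Z"
  shows "diag \<le>\<^sub>T Z"
proof -
  have "decidable (\<lambda>z. acts (pi2 z) \<and> pi1 z = witness (pi2 z))"
    by (intro recursive_intros stage_intros decidable_acts)
  then obtain h where h: "recursive h"
      "\<And>x. h x \<in> halting_set \<longleftrightarrow> (\<exists>s. acts s \<and> x = witness s)"
    using search_many_one_halting[of "\<lambda>x s. acts s \<and> x = witness s"] by metis
  have h_diag: "h x \<in> halting_set \<longleftrightarrow> x \<in> diag" for x
    unfolding h(2) diag_def by blast
  obtain q where q: "\<And>x. run Z q x (h x) {}"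
    using h(1) unfolding recursive_def by metis
  obtain p where p: "\<And>x. \<exists>Q. run Z p x (of_bool (x \<in> halting_set)) Q"
    using assms unfolding turing_le_def by metis
  have "\<exists>Q. run Z (Comp p q) x (of_bool (x \<in> diag)) Q" for x
  proof -
    obtain Q where "run Z p (h x) (of_bool (h x \<in> halting_set)) Q" using p by blast
    from run.Comp[OF q this] show ?thesis unfolding h_diag by blast
  qed
  then show ?thesis unfolding turing_le_def by blast
qed

text \<open>
  Whenever a number enters \<open>B\<close>, the smaller number \<open>first_fresh\<close> enters \<open>A\<close> at the same stage.
\<close>
lemma B_stage_settled:
  assumes "A_stage s \<inter> {..<x} = A_lim \<inter> {..<x}" "x \<in> B_stage t"
  shows "x \<in> B_stage s"
proof (rule ccontr)
  assume "x \<notin> B_stage s"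
  have "x \<in> B_stage t \<longrightarrow> x \<in> B_stage s" if "s \<le> t" for t
    using that
  proof (induction t rule: dec_induct)
    case (step t)
    show ?case
    proof (intro impI, cases "x \<in> B_stage t")
      case False
      assume "x \<in> B_stage (Suc t)"
      then have *: "acts t" "first_fresh t \<le> x" "x < t" "x \<notin> guess t"
        using False by (auto simp: B_stage_Suc split: if_splits)
      then have fresh: "fresh t (first_fresh t)" by (intro fresh_first_fresh) auto
      then have "first_fresh t \<in> A_stage (Suc t)" using * by (simp add: A_stage_Suc fresh_def)
      then have "first_fresh t \<in> A_lim" by (auto simp: A_lim_def)
      moreover have "first_fresh t \<notin> A_stage s"
        using fresh A_stage_mono[OF step.hyps(1)] by (auto simp: fresh_def)
      \<comment> \<open>Strict, because \<open>first_fresh t\<close> lies in \<open>guess t\<close>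
        and \<open>x\<close> does not.\<close>
      moreover have "first_fresh t < x" using fresh * by (auto simp: fresh_def le_less)
      ultimately show "x \<in> B_stage s" using assms(1) by blast
    qed (use step.IH in simp)
  qed simp
  then show False
    using assms(2) \<open>x \<notin> B_stage s\<close> B_stage_mono[of t s] by (cases "s \<le> t") auto
qed

text \<open>Search for a stage at which \<open>A\<close> is final below \<open>x\<close> and read
  off \<open>B\<close> there. Every test queries only numbers below \<open>x\<close>, so the
  identity bounds the use.\<close>

lemma B_wtt_le_A: "B_lim \<le>\<^sub>w\<^sub>t\<^sub>t A_lim"
proof -
  \<comment> \<open>The input pairs the recursion state \<open>((x, s), (n, w))\<close> with the
    oracle's answer on \<open>n\<close>; the count \<open>w\<close> grows if that answer contradicts
    stage \<open>s\<close>.\<close>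
  have "recursive (\<lambda>z. pi2 (pi2 (pi1 z))
      + of_bool (pi1 (pi2 (pi1 z)) \<in> A_stage (pi2 (pi1 (pi1 z))) \<longleftrightarrow> pi2 z = 0))" (is "recursive ?f")
    by (intro recursive_intros decidable_A_stage)
  then obtain f where f: "\<And>z. run A_lim f z (?f z) {}"
    unfolding recursive_def by blast
  define query where "query = Comp Query (Comp First Second)"
  define count where "count = Rec Zero (Comp f (Pairing (Pairing First Second) query))"
  have run_count: "\<exists>Q\<subseteq>{..<n}. run A_lim count (pr (pr x s) n)
      (\<Sum>i<n. of_bool (i \<in> A_stage s \<longleftrightarrow> i \<notin> A_lim)) Q" for x s n
  proof (induction n)
    case 0
    show ?case
      unfolding count_def pr_def using run.Rec_0[OF run.Zero] by fastforce
  next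
    case (Suc n)
    let ?w = "\<Sum>i<n. of_bool (i \<in> A_stage s \<longleftrightarrow> i \<notin> A_lim) :: nat"
    let ?z = "pr (pr x s) (pr n ?w)"
    obtain Q where Q: "Q \<subseteq> {..<n}" "run A_lim count (pr (pr x s) n) ?w Q"
      using Suc by blast
    have "run A_lim (Comp First Second) ?z n {}"
      using run_Comp0[OF run.Second run.First, of A_lim ?z]
      by (simp flip: pi1_def pi2_def)
    then have "run A_lim query ?z (of_bool (n \<in> A_lim)) {n}"
      unfolding query_def using run.Comp[OF _ run.Query] by fastforce
    then have "run A_lim (Pairing (Pairing First Second) query) ?z
        (pr ?z (of_bool (n \<in> A_lim))) {n}"
      using run.Pairing[OF run_id] unfolding pr_def by fastforce
    from run.Comp[OF this f]
    have "run A_lim (Comp f (Pairing (Pairing First Second) query)) ?z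
        (?w + of_bool (n \<in> A_stage s \<longleftrightarrow> n \<notin> A_lim)) {n}" by simp
    from run.Rec_Suc[OF Q(2)[unfolded count_def pr_def], OF this[unfolded pr_def]]
    have "run A_lim count (pr (pr x s) (Suc n))
        (\<Sum>i<Suc n. of_bool (i \<in> A_stage s \<longleftrightarrow> i \<notin> A_lim)) (Q \<union> {n})"
      unfolding count_def pr_def by simp
    then show ?case using Q(1) by (intro exI[of _ "Q \<union> {n}"]) auto
  qed
  have "recursive (\<lambda>z. of_bool (0 < z))" by (intro recursive_intros)
  then obtain pos where pos: "\<And>z. run A_lim pos z (of_bool (0 < z)) {}"
    unfolding recursive_def by metis
  define test where "test = Comp pos (Comp count (Pairing (Pairing First Second) First))"
  have run_test: "\<exists>Q\<subseteq>{..<x}. run A_lim test (pr x s)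
      (of_bool (\<not> A_stage s \<inter> {..<x} = A_lim \<inter> {..<x})) Q" for x s
  proof -
    obtain Q where Q: "Q \<subseteq> {..<x}" "run A_lim count (pr (pr x s) x)
      (\<Sum>i<x. of_bool (i \<in> A_stage s \<longleftrightarrow> i \<notin> A_lim)) Q" using run_count by blast
    have "run A_lim First (pr x s) x {}"
      using run.First[of A_lim "pr x s"] by (simp flip: pi1_def)
    then have "run A_lim (Pairing (Pairing First Second) First) (pr x s) (pr (pr x s) x) {}"
      by (intro run_Pairing0 run_id)
    from run.Comp[OF run.Comp[OF this Q(2)] pos]
    have "run A_lim test (pr x s)
        (of_bool (0 < (\<Sum>i<x. of_bool (i \<in> A_stage s \<longleftrightarrow> i \<notin> A_lim) :: nat))) Q"
      unfolding test_def by simp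
    moreover have "0 < (\<Sum>i<x. of_bool (i \<in> A_stage s \<longleftrightarrow> i \<notin> A_lim) :: nat)
        \<longleftrightarrow> \<not> A_stage s \<inter> {..<x} = A_lim \<inter> {..<x}"
      by (auto simp: zero_less_iff_neq_zero simp del: sum_of_bool_eq)
    ultimately have "run A_lim test (pr x s) (of_bool (\<not> A_stage s \<inter> {..<x} = A_lim \<inter> {..<x})) Q"
      by (simp only:)
    with Q(1) show ?thesis by blast
  qed
  have "recursive (\<lambda>z. of_bool (pi1 z \<in> B_stage (pi2 z)))"
    by (intro recursive_intros decidable_B_stage)
  then obtain b where b: "\<And>z. run A_lim b z (of_bool (pi1 z \<in> B_stage (pi2 z))) {}"
    unfolding recursive_def by metis
  define p where "p = Comp b (Pairing (Pairing First Second)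
    (Comp (Mu test) (Pairing (Pairing First Second) Zero)))"
  have "\<exists>Q. run A_lim p x (of_bool (x \<in> B_lim)) Q \<and> Q \<subseteq> {..<x}" for x
  proof -
    have "\<exists>s. A_stage s \<inter> {..<x} = A_lim \<inter> {..<x}"
    proof -
      \<comment> \<open>\<open>g y\<close> is a stage by which \<open>y\<close> has entered
        \<open>A\<close>; the sum dominates all those for \<open>y < x\<close>.\<close>
      obtain g where g: "\<And>y. y \<in> A_lim \<Longrightarrow> y \<in> A_stage (g y)" unfolding A_lim_def by (metis UN_E)
      have "y \<in> A_stage (\<Sum>i<x. g i)" if "y \<in> A_lim" "y < x" for y
        using g[OF that(1)] A_stage_mono[of "g y" "\<Sum>i<x. g i"] member_le_sum[of y "{..<x}" g] that(2)
        by auto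
      then show ?thesis by (intro exI[of _ "\<Sum>i<x. g i"]) (auto simp: A_lim_def)
    qed
    then obtain s0 where s0: "A_stage s0 \<inter> {..<x} = A_lim \<inter> {..<x}" ..
    obtain s Q where s: "A_stage s \<inter> {..<x} = A_lim \<inter> {..<x}" "Q \<subseteq> {..<x}"
        "run A_lim (Mu test) (pr x 0) s Q"
      using run_Mu_exists[where P = "\<lambda>s. A_stage s \<inter> {..<x} = A_lim \<inter> {..<x}", OF run_test s0 le0]
      by metis
    have "run A_lim (Pairing (Pairing First Second) Zero) x (pr x 0) {}"
      by (intro run_Pairing0 run_id run.Zero)
    from run.Comp[OF this s(3)]
    have "run A_lim (Pairing (Pairing First Second)
        (Comp (Mu test) (Pairing (Pairing First Second) Zero))) x (pr x s) Q"
      using run.Pairing[OF run_id] unfolding pr_def by fastforce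
    from run.Comp[OF this b]
    have "run A_lim p x (of_bool (x \<in> B_stage s)) Q" unfolding p_def by simp
    moreover have "x \<in> B_stage s \<longleftrightarrow> x \<in> B_lim"
      using B_stage_settled[OF s(1)] by (auto simp: B_lim_def)
    ultimately have "run A_lim p x (of_bool (x \<in> B_lim)) Q" by (simp only:)
    then show ?thesis using s(2) by blast
  qed
  moreover have "computable (\<lambda>x. x)"
    unfolding computable_def using run_id by blast
  ultimately show ?thesis unfolding wtt_le_def by blast
qed

theorem theorem7:
  "\<exists>A B :: nat set. ce A \<and> ce B \<and> B \<le>\<^sub>w\<^sub>t\<^sub>t A \<and> A \<inter> B = {} \<and> infinite (UNIV - (A \<union> B)) \<and>
     \<not> (\<exists>Z. separator A B Z \<and> halting_set \<le>\<^sub>T Z)"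
proof (intro exI conjI)
  show "ce A_lim" "ce B_lim" by (rule ce_A_lim ce_B_lim)+
  show "B_lim \<le>\<^sub>w\<^sub>t\<^sub>t A_lim" by (rule B_wtt_le_A)
  show "A_lim \<inter> B_lim = {}" by (rule lim_disjoint)
  show "infinite (UNIV - (A_lim \<union> B_lim))" by (rule infinite_undecided)
  show "\<not> (\<exists>Z. separator A_lim B_lim Z \<and> halting_set \<le>\<^sub>T Z)"
    using separator_not_compute_diag halting_le_imp_diag_le by blast
qed

end
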